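(* Let $f_{m,n}(z)=\sum_{j=0}^{n}\binom{n}{j}z^{\binom{j}{m}}$ for integers $m\ge 1$, $n\ge 0$. Then for all integers $1\le m\le n$ we have the polynomial identity $$f_{m,n}(z)=\sum_{i=0}^{m-1}\binom{n}{i}+z\sum_{i=m}^{n}\frac{\binom{n-i+m-1}{m-1}}{\binom{i}{m}}f_{m,i}'(z),$$ where $'$ denotes the derivative with respect to $z$.
   Context: Conventions: $\binom{j}{m}=0$ for $0\le j<m$, and $z^0=1$. *)

theory Defs
  imports "HOL-Computational_Algebra.Polynomial"
begin

(* The coefficients are natural numbers, so the polynomial is defined over an arbitrary
   field of characteristic 0.  For j < m the library has j choose m = 0, so those terms are
   constants, in line with the conventions binom(j,m) = 0 for j < m and z^0 = 1. *)
definition f :: "nat \<Rightarrow> nat \<Rightarrow> 'a::field_char_0 poly" where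
  "f m n = (\<Sum>j=0..n. monom (of_nat (n choose j)) (j choose m))"

end

theory Submission
  imports Defs
begin

text \<open>
  Applying \<open>z d/dz\<close> to \<open>f m i\<close> multiplies the \<open>j\<close>-th term by \<open>j choose m\<close>; since
  \<open>(i choose j) * (j choose m) = (i choose m) * ((i - m) choose (j - m))\<close>, dividing by
  \<open>i choose m\<close> leaves the coefficient \<open>(i - m) choose (j - m)\<close>.  Summing over \<open>i\<close>
  with the given weights is a Vandermonde-type convolution of upper indices, which restores
  \<open>n choose j\<close> for \<open>j \<ge> m\<close>; the terms with \<open>j < m\<close> are constant.
\<close>

text \<open>Both sides count the subsets of \<open>{0..N + p}\<close> with \<open>p + q + 1\<close>
  elements: the left side sorts them by the value \<open>k\<close> of the element that has exactly
  \<open>q\<close> chosen elements below it and \<open>p\<close> above it.\<close>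

lemma sum_choose_mult_choose_upper:
  "(\<Sum>k\<le>N. (k choose q) * ((N - k + p) choose p)) = (N + p + 1) choose (p + q + 1)"
proof (induction p arbitrary: N)
  case 0
  show ?case using sum_choose_upper[of q N] by (simp add: atMost_atLeast0)
next
  case (Suc p)
  note IHp = Suc.IH
  show ?case
  proof (induction N)
    case 0
    show ?case by (cases q) (simp_all add: binomial_eq_0)
  next
    case (Suc N)
    \<comment> \<open>Pascal's rule on the second factor gives one sum with smaller \<open>p\<close>
      and one that reduces to smaller \<open>N\<close>.\<close>
    have "(\<Sum>k\<le>Suc N. (k choose q) * ((Suc N - k + Suc p) choose Suc p))
        = (\<Sum>k\<le>Suc N. (k choose q) * ((Suc N - k + p) choose p))
          + (\<Sum>k\<le>Suc N. (k choose q) * ((Suc N - k + p) choose Suc p))"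
      by (simp add: sum.distrib distrib_left)
    \<comment> \<open>The term \<open>k = Suc N\<close> vanishes, being a multiple of
      \<open>p choose Suc p\<close>.\<close>
    also have "(\<Sum>k\<le>Suc N. (k choose q) * ((Suc N - k + p) choose Suc p))
        = (\<Sum>k\<le>N. (k choose q) * ((N - k + Suc p) choose Suc p))"
      by (simp add: Suc_diff_le)
    finally show ?case by (simp only: IHp Suc.IH) simp
  qed
qed

lemma smult_sum_right: "smult c (\<Sum>x\<in>A. p x) = (\<Sum>x\<in>A. smult c (p x))"
  by (induction A rule: infinite_finite_induct) (simp_all add: smult_add_right)

lemma pderiv_sum: "pderiv (\<Sum>x\<in>A. p x) = (\<Sum>x\<in>A. pderiv (p x))"
  using higher_pderiv_sum[of 1 p A] by simp

text \<open>Monomials are eigenvectors of the Euler operator \<open>z d/dz\<close>, where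
  \<open>[:0, 1:]\<close> is the polynomial \<open>z\<close>.\<close>

lemma X_mult_pderiv_monom:
  "[:0, 1:] * pderiv (monom c k) = monom (of_nat k * c) k"
  by (cases k) (simp_all add: pderiv_monom flip: monom_Suc)

lemma X_mult_pderiv_f:
  assumes "m \<le> i"
  shows "[:0, 1:] * smult (1 / of_nat (i choose m)) (pderiv (f m i)) =
    (\<Sum>j=m..i. monom (of_nat ((i - m) choose (j - m))) (j choose m) :: 'a::field_char_0 poly)"
proof -
  have "[:0, 1:] * smult (1 / of_nat (i choose m)) (pderiv (f m i :: 'a poly)) =
    (\<Sum>j=0..i. smult (1 / of_nat (i choose m))
       (monom (of_nat (j choose m) * of_nat (i choose j)) (j choose m)))"
    unfolding f_def pderiv_sum smult_sum_right sum_distrib_left mult_smult_right X_mult_pderiv_monom ..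
  also have "\<dots> = (\<Sum>j=m..i. smult (1 / of_nat (i choose m))
       (monom (of_nat (j choose m) * of_nat (i choose j)) (j choose m)))"
    by (rule sum.mono_neutral_right) (auto simp: not_le binomial_eq_0)
  also have "\<dots> = (\<Sum>j=m..i. monom (of_nat ((i - m) choose (j - m))) (j choose m))"
  proof (rule sum.cong)
    fix j assume j: "j \<in> {m..i}"
    have "(i choose j) * (j choose m) = (i choose m) * ((i - m) choose (j - m))"
      using j by (intro choose_mult) auto
    hence "(of_nat (i choose j) * of_nat (j choose m) :: 'a)
        = of_nat (i choose m) * of_nat ((i - m) choose (j - m))"
      by (metis of_nat_mult)
    thus "smult (1 / of_nat (i choose m))
        (monom (of_nat (j choose m) * of_nat (i choose j) :: 'a) (j choose m))
        = monom (of_nat ((i - m) choose (j - m))) (j choose m)"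
      \<comment> \<open>Since \<open>m \<le> i\<close>, the number \<open>i choose m\<close> is
        nonzero in characteristic 0 and cancels.\<close>
      using assms by (simp add: smult_monom mult.commute)
  qed simp
  finally show ?thesis .
qed

text \<open>After the shift \<open>k = i - m\<close> this is the convolution above with
  \<open>N = n - m\<close>, \<open>p = m - 1\<close> and \<open>q = j - m\<close>, so that
  \<open>N + p + 1 = n\<close> and \<open>p + q + 1 = j\<close>.\<close>

lemma sum_choose_weights:
  assumes "1 \<le> m" "m \<le> j" "j \<le> n"
  shows "(\<Sum>i=m..n. ((n - i + m - 1) choose (m - 1)) * ((i - m) choose (j - m))) = n choose j"
proof -
  have "(\<Sum>i=m..n. ((n - i + m - 1) choose (m - 1)) * ((i - m) choose (j - m)))
      = (\<Sum>k\<le>n - m. (k choose (j - m)) * ((n - m - k + (m - 1)) choose (m - 1)))"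
    using assms by (intro sum.reindex_bij_witness[of _ "\<lambda>k. k + m" "\<lambda>i. i - m"]) auto
  also have "\<dots> = n choose j"
    unfolding sum_choose_mult_choose_upper using assms by simp
  finally show ?thesis .
qed

theorem corollary4p2:
  fixes m n :: nat
  assumes "1 \<le> m" and "m \<le> n"
  shows "(f m n :: 'a::field_char_0 poly) =
    [:\<Sum>i=0..m-1. of_nat (n choose i):] +
    [:0, 1:] * (\<Sum>i=m..n.
      smult (of_nat ((n - i + m - 1) choose (m - 1)) / of_nat (i choose m)) (pderiv (f m i)))"
proof -
  define w where "w = (\<lambda>i. (n - i + m - 1) choose (m - 1))"
  define b where "b = (\<lambda>i j. (i - m) choose (j - m))"
  have "[:0, 1:] * (\<Sum>i=m..n. smult (of_nat (w i) / of_nat (i choose m)) (pderiv (f m i :: 'a poly)))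
      = (\<Sum>i=m..n. smult (of_nat (w i))
          ([:0, 1:] * smult (1 / of_nat (i choose m)) (pderiv (f m i))))"
    by (simp add: sum_distrib_left)
  also have "\<dots> = (\<Sum>i=m..n. smult (of_nat (w i)) (\<Sum>j=m..i. monom (of_nat (b i j)) (j choose m)))"
    by (intro sum.cong refl) (simp only: X_mult_pderiv_f b_def atLeastAtMost_iff)
  also have "\<dots> = (\<Sum>i=m..n. \<Sum>j=m..i. monom (of_nat (w i * b i j)) (j choose m))"
    by (simp add: smult_sum_right smult_monom)
  \<comment> \<open>As \<open>b i j = 0\<close> for \<open>j > i\<close>, the triangle of indices
    extends to a square, where the two sums can be swapped.\<close>
  also have "\<dots> = (\<Sum>i=m..n. \<Sum>j=m..n. monom (of_nat (w i * b i j)) (j choose m))"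
    by (intro sum.cong refl sum.mono_neutral_left) (auto simp: b_def binomial_eq_0)
  also have "\<dots> = (\<Sum>j=m..n. monom (of_nat (\<Sum>i=m..n. w i * b i j)) (j choose m))"
    by (subst sum.swap) (simp add: monom_sum)
  also have "\<dots> = (\<Sum>j=m..n. monom (of_nat (n choose j)) (j choose m))"
    using sum_choose_weights[OF assms(1)] by (intro sum.cong refl) (simp add: w_def b_def)
  finally have upper: "[:0, 1:] * (\<Sum>i=m..n. smult (of_nat (w i) / of_nat (i choose m)) (pderiv (f m i)))
      = (\<Sum>j=m..n. monom (of_nat (n choose j)) (j choose m) :: 'a poly)" .
  have "[:\<Sum>i=0..m-1. of_nat (n choose i) :: 'a:]
      = (\<Sum>j=0..m-1. monom (of_nat (n choose j)) 0)"
    by (simp add: monom_0 [symmetric] monom_sum)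
  \<comment> \<open>Here \<open>1 \<le> m\<close> gives \<open>j < m\<close>, so the exponent
    \<open>j choose m\<close> is 0.\<close>
  also have "\<dots> = (\<Sum>j=0..m-1. monom (of_nat (n choose j)) (j choose m))"
    using assms by (intro sum.cong refl) (simp add: binomial_eq_0)
  finally have lower: "[:\<Sum>i=0..m-1. of_nat (n choose i) :: 'a:]
      = (\<Sum>j=0..m-1. monom (of_nat (n choose j)) (j choose m))" .
  have "{0..n} = {0..m-1} \<union> {m..n}" "{0..m-1} \<inter> {m..n} = {}"
    using assms by auto
  then have "f m n = (\<Sum>j=0..m-1. monom (of_nat (n choose j)) (j choose m))
      + (\<Sum>j=m..n. monom (of_nat (n choose j)) (j choose m) :: 'a poly)"
    unfolding f_def by (simp only: sum.union_disjoint finite_atLeastAtMost)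
  then show ?thesis
    unfolding upper[unfolded w_def] lower .
qed

end
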